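(* Let $K_4^2$ be the two-dimensional radially deformed Fourier kernel with parameter $a=4$ (see context). For all $z>0$ and $\xi=\cos\theta\in[-1,1]$, $$K_4^2(z,\xi)=e^{-iz^2(\xi^2-1/2)}\,\mathrm{erfc}\left[-e^{-i\frac{\pi}{4}}z\xi\right]=(1-i)\left(\frac{2}{\pi}\right)^{1/2}e^{-\frac{i}{2}z^2\cos2\theta}\int_{-\infty}^{z\cos\theta}e^{it^2}\,dt.$$ Furthermore, $$\left|K_4^2(z,\xi)\right|\le 1+2\sqrt{\frac{2}{\pi}}\qquad\text{for all }(z,\xi)\in\mathbb{R}^+\times[-1,1],$$ and in particular $$\lim_{z\to+\infty}\left|K_4^2(z,1)\right|=2.$$
   Context: For $a>0$, $z>0$, $\theta\in[0,\pi]$ and $\xi=\cos\theta$, the two-dimensional radially deformed Fourier kernel is $$K_a^2(z,\xi)=J_0(z_a)+2\sum_{k=1}^{\infty}e^{-\frac{i\pi k}{a}}J_{\frac{2k}{a}}(z_a)\cos k\theta,\qquad z_a=\frac{2}{a}z^{a/2},$$ where $J_\nu$ is the Bessel function of the first kind. Here $a=4$. The error function is the entire function $\mathrm{erf}(w)=\frac{2}{\sqrt\pi}\int_0^w e^{-t^2}\,dt$, and $\mathrm{erfc}(w)=1-\mathrm{erf}(w)$. The integral $\int_{-\infty}^{u}e^{it^2}\,dt$ is a convergent improper integral. *)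

theory Defs
  imports "HOL-Complex_Analysis.Complex_Analysis" "HOL-Real_Asymp.Real_Asymp"
begin

text \<open>
  The Bessel function of the first kind on the positive half-line, for real order
  \<open>\<nu> \<ge> 0\<close>. Since \<open>powr\<close> vanishes at base 0, the value at \<open>x = 0\<close> is not the
  limiting one for \<open>\<nu> = 0\<close>.
\<close>

definition bessel_J :: "real \<Rightarrow> real \<Rightarrow> real" where
  "bessel_J \<nu> x =
     (\<Sum>m. (- 1) ^ m / (fact m * Gamma (real m + \<nu> + 1)) * (x / 2) powr (2 * real m + \<nu>))"

text \<open>
  The angle \<open>\<theta> \<in> [0, \<pi>]\<close> with \<open>\<xi> = cos \<theta>\<close> is \<open>arccos \<xi>\<close>. The series
  over \<open>k \<ge> 1\<close> is indexed by \<open>Suc k\<close> with \<open>k \<ge> 0\<close>.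
\<close>

definition deformed_arg :: "real \<Rightarrow> real \<Rightarrow> real" where
  "deformed_arg a z = 2 / a * z powr (a / 2)"

definition kernel_term :: "real \<Rightarrow> real \<Rightarrow> real \<Rightarrow> nat \<Rightarrow> complex" where
  "kernel_term a z \<xi> k =
     exp (- (\<i> * of_real pi * of_nat k / of_real a)) *
     of_real (bessel_J (2 * real k / a) (deformed_arg a z)) *
     of_real (cos (real k * arccos \<xi>))"

definition deformed_kernel :: "real \<Rightarrow> real \<Rightarrow> real \<Rightarrow> complex" where
  "deformed_kernel a z \<xi> =
     of_real (bessel_J 0 (deformed_arg a z)) + 2 * (\<Sum>k. kernel_term a z \<xi> (Suc k))"

definition erf :: "complex \<Rightarrow> complex" where
  "erf w = 2 / of_real (sqrt pi) * contour_integral (linepath 0 w) (\<lambda>t. exp (- t\<^sup>2))"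

definition erfc :: "complex \<Rightarrow> complex" where
  "erfc w = 1 - erf w"


subsection \<open>The series and the improper integral converge\<close>

lemma Gamma_shift_ge:
  assumes "\<nu> \<ge> (0::real)"
  shows "Gamma (\<nu> + 1) \<le> Gamma (real m + \<nu> + 1)"
proof (induction m)
  case (Suc m)
  have "Gamma (real m + \<nu> + 1 + 1) = (real m + \<nu> + 1) * Gamma (real m + \<nu> + 1)"
    using assms by (intro Gamma_plus1) (auto simp: nonpos_Ints_def)
  moreover have "Gamma (real m + \<nu> + 1) > 0"
    using assms by (intro Gamma_real_pos) auto
  ultimately have "Gamma (real m + \<nu> + 1) \<le> Gamma (real m + \<nu> + 1 + 1)"
    using assms by (simp add: algebra_simps)
  then show ?case using Suc by (simp add: algebra_simps)
qed auto

lemma bessel_J_terms: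
  assumes "\<nu> \<ge> 0" "x > 0"
  defines "c \<equiv> (x / 2) powr \<nu> / Gamma (\<nu> + 1)"
  shows "summable (\<lambda>m. (- 1) ^ m / (fact m * Gamma (real m + \<nu> + 1)) * (x / 2) powr (2 * real m + \<nu>))"
    and "\<bar>bessel_J \<nu> x\<bar> \<le> c * exp ((x / 2)\<^sup>2)"
proof -
  let ?f = "\<lambda>m. (- 1) ^ m / (fact m * Gamma (real m + \<nu> + 1)) * (x / 2) powr (2 * real m + \<nu>)"
  let ?g = "\<lambda>m. c * (((x / 2)\<^sup>2) ^ m /\<^sub>R fact m)"
  have le: "norm (?f m) \<le> ?g m" for m
  proof -
    have pos: "Gamma (\<nu> + 1) > 0" "Gamma (real m + \<nu> + 1) > 0"
      using assms by (auto intro!: Gamma_real_pos)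
    have "(x / 2) powr (2 * real m + \<nu>) = (x / 2) powr \<nu> * ((x / 2)\<^sup>2) ^ m"
      using assms by (simp add: powr_add powr_realpow flip: power_mult)
         (simp add: powr_realpow[of "x/2" "2*m", simplified] power_divide)
    then have "norm (?f m) = (x / 2) powr \<nu> * ((x / 2)\<^sup>2) ^ m / (fact m * Gamma (real m + \<nu> + 1))"
      using pos assms by (simp add: abs_mult power_abs)
    also have "\<dots> \<le> (x / 2) powr \<nu> * ((x / 2)\<^sup>2) ^ m / (fact m * Gamma (\<nu> + 1))"
      using pos Gamma_shift_ge[of \<nu> m] assms
      by (intro divide_left_mono mult_left_mono mult_pos_pos mult_nonneg_nonneg) auto
    also have "\<dots> = ?g m"
      by (simp only: c_def real_scaleR_def divide_inverse inverse_mult_distrib mult_ac)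
    finally show ?thesis .
  qed
  have g: "?g sums (c * exp ((x / 2)\<^sup>2))"
    by (intro sums_mult exp_converges)
  show "summable ?f"
    by (rule summable_comparison_test'[OF sums_summable[OF g]]) (use le in auto)
  have sn: "summable (\<lambda>m. norm (?f m))"
    by (rule summable_comparison_test'[OF sums_summable[OF g]]) (use le in auto)
  have "norm (suminf ?f) \<le> (\<Sum>m. norm (?f m))"
    by (rule summable_norm[OF sn])
  also have "\<dots> \<le> suminf ?g"
    by (rule suminf_le[OF le sn sums_summable[OF g]])
  also have "\<dots> = c * exp ((x / 2)\<^sup>2)"
    using g by (rule sums_unique[symmetric])
  finally show "\<bar>bessel_J \<nu> x\<bar> \<le> c * exp ((x / 2)\<^sup>2)"
    by (simp add: bessel_J_def)
qed

lemma Gamma_ge_powr: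
  assumes "s \<ge> 0" "T > (0::real)"
  shows "T powr s * exp (- T) \<le> Gamma (s + 1)"
proof (rule has_integral_le)
  show "((\<lambda>t. t powr (s + 1 - 1) / exp t) has_integral Gamma (s + 1)) {0..}"
    using assms by (intro Gamma_integral_real) auto
  have "((\<lambda>t. exp (- 1 * t)) has_integral exp (- 1 * T) / 1) {T..}"
    by (rule has_integral_exp_minus_to_infinity) auto
  then have e: "((\<lambda>t. T powr s * exp (- t)) has_integral T powr s * exp (- T)) {T..}"
    by (intro has_integral_mult_right) auto
  show "((\<lambda>t. if t \<in> {T..} then T powr s * exp (- t) else 0) has_integral T powr s * exp (- T)) {0..}"
    using e by (subst has_integral_restrict) (use assms in auto)
  show "(if t \<in> {T..} then T powr s * exp (- t) else 0) \<le> t powr (s + 1 - 1) / exp t"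
    if "t \<in> {0..}" for t
    using assms by (auto simp: exp_minus divide_inverse intro!: mult_right_mono powr_mono2)
qed

lemma summable_kernel_term:
  assumes "a > 0" "z > 0"
  shows "summable (\<lambda>k. kernel_term a z \<xi> (Suc k))"
proof -
  define x where "x = deformed_arg a z"
  have x: "x > 0" using assms by (simp add: x_def deformed_arg_def)
  define T where "T = (x / 2) * 2 powr (a / 2)"
  have T: "T > 0" using x by (simp add: T_def)
  define C where "C = exp T * exp ((x / 2)\<^sup>2)"
  have "norm (kernel_term a z \<xi> k) \<le> C * (1 / 2) ^ k" for k
  proof -
    define \<nu> where "\<nu> = 2 * real k / a"
    have \<nu>: "\<nu> \<ge> 0" using assms by (simp add: \<nu>_def)
    have "norm (exp (- (\<i> * of_real pi * of_nat k / of_real a))) = 1"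
      by (simp add: norm_exp_eq_Re)
    then have "norm (kernel_term a z \<xi> k) = \<bar>bessel_J \<nu> x\<bar> * \<bar>cos (real k * arccos \<xi>)\<bar>"
      by (simp add: kernel_term_def norm_mult \<nu>_def x_def)
    also have "\<dots> \<le> \<bar>bessel_J \<nu> x\<bar>"
      using abs_cos_le_one[of "real k * arccos \<xi>"] by (intro mult_right_le_one_le) auto
    also have "\<dots> \<le> (x / 2) powr \<nu> / Gamma (\<nu> + 1) * exp ((x / 2)\<^sup>2)"
      by (rule bessel_J_terms(2)[OF \<nu> x])
    also have "\<dots> \<le> (x / 2) powr \<nu> / (T powr \<nu> * exp (- T)) * exp ((x / 2)\<^sup>2)"
      using Gamma_ge_powr[OF \<nu> T] T \<nu>
      by (intro mult_right_mono divide_left_mono mult_pos_pos Gamma_real_pos) auto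
    also have "T powr \<nu> = (x / 2) powr \<nu> * 2 ^ k"
    proof -
      have "T powr \<nu> = (x / 2) powr \<nu> * (2 powr (a / 2)) powr \<nu>"
        unfolding T_def by (rule powr_mult)
      also have "(2 powr (a / 2)) powr \<nu> = (2::real) ^ k"
        using assms by (simp add: powr_powr \<nu>_def powr_realpow)
      finally show ?thesis .
    qed
    also have "(x / 2) powr \<nu> / ((x / 2) powr \<nu> * 2 ^ k * exp (- T)) * exp ((x / 2)\<^sup>2) = C * (1 / 2) ^ k"
      using x by (simp add: C_def exp_minus power_divide field_simps)
    finally show ?thesis .
  qed
  moreover have "summable (\<lambda>k. C * (1 / 2 :: real) ^ k)"
    by (rule summable_mult, rule summable_geometric) simp
  ultimately have "summable (\<lambda>k. kernel_term a z \<xi> k)"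
    by (rule summable_comparison_test'[rotated])
  then show ?thesis by (rule summable_Suc_iff[THEN iffD2])
qed


text \<open>The Henstock--Kurzweil integral over a half-line is the improper integral.\<close>

lemma has_integral_atMost_iff_tendsto:
  fixes f :: "real \<Rightarrow> 'a::banach"
  assumes "\<And>R. f integrable_on {R..u}"
  shows "(f has_integral I) {..u} \<longleftrightarrow> ((\<lambda>R. integral {R..u} f) \<longlongrightarrow> I) at_bot"
proof -
  define F where "F = (\<lambda>x. if x \<in> {..u} then f x else 0)"
  have eq: "integral (cbox a b) F = integral {a..u} f" if "b \<ge> u" for a b
  proof -
    have "integral {a..b} F = integral ({..u} \<inter> {a..b}) f"
      unfolding F_def by (rule integral_restrict_Int)
    also have "{..u} \<inter> {a..b} = {a..u}"
      using that by (auto intro: order_trans)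
    finally show ?thesis by simp
  qed
  have int: "F integrable_on cbox a b" for a b
  proof -
    have "{..u} \<inter> cbox a b = {a..min b u}" by auto
    moreover have "f integrable_on {a..min b u}"
      by (rule integrable_on_subinterval[OF assms[of a]]) auto
    ultimately show ?thesis
      unfolding F_def integrable_restrict_Int by (simp only:)
  qed
  have alt: "(f has_integral I) {..u} \<longleftrightarrow>
      (\<forall>e>0. \<exists>B>0. \<forall>a b. ball 0 B \<subseteq> cbox a b \<longrightarrow> norm (integral (cbox a b) F - I) < e)"
    unfolding has_integral_alt' F_def[symmetric] by (simp only: int simp_thms)
  show ?thesis
  proof
    assume hi: "(f has_integral I) {..u}"
    show "((\<lambda>R. integral {R..u} f) \<longlongrightarrow> I) at_bot"
    proof (rule tendstoI)
      fix e :: real assume "e > 0"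
      then obtain B where B: "\<And>a b. ball 0 B \<subseteq> cbox a b \<Longrightarrow> norm (integral (cbox a b) F - I) < e"
        using hi unfolding alt by blast
      have "dist (integral {R..u} f) I < e" if "R \<le> - B" for R
      proof -
        have "ball 0 B \<subseteq> cbox R (max B u)" using that by (auto simp: dist_norm)
        from B[OF this] show ?thesis unfolding dist_norm by (subst (asm) eq) auto
      qed
      then show "\<forall>\<^sub>F R in at_bot. dist (integral {R..u} f) I < e"
        unfolding eventually_at_bot_linorder by blast
    qed
  next
    assume lim: "((\<lambda>R. integral {R..u} f) \<longlongrightarrow> I) at_bot"
    show "(f has_integral I) {..u}"
      unfolding alt
    proof (intro allI impI)
      fix e :: real assume e: "e > 0"
      obtain R0 where R0: "\<And>R. R \<le> R0 \<Longrightarrow> dist (integral {R..u} f) I < e"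
        using tendstoD[OF lim e] unfolding eventually_at_bot_linorder by blast
      define B where "B = \<bar>R0\<bar> + \<bar>u\<bar> + 1"
      have "B > 0" "R0 \<in> ball 0 B" "u \<in> ball 0 B"
        by (auto simp: dist_norm B_def)
      moreover have "norm (integral (cbox a b) F - I) < e" if "ball 0 B \<subseteq> cbox a b" for a b
      proof -
        have "R0 \<in> cbox a b" "u \<in> cbox a b" using that \<open>R0 \<in> ball 0 B\<close> \<open>u \<in> ball 0 B\<close> by blast+
        then have "a \<le> R0" "u \<le> b" by simp_all
        then show ?thesis using R0[of a] eq[of b a] by (simp only: dist_norm)
      qed
      ultimately show "\<exists>B>0. \<forall>a b. ball 0 B \<subseteq> cbox a b \<longrightarrow> norm (integral (cbox a b) F - I) < e"
        by blast
    qed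
  qed
qed

lemma oscillatory_integrable_on_atMost:
  "(\<lambda>t::real. exp (\<i> * of_real (t\<^sup>2))) integrable_on {..u}"
proof -
  define f where "f = (\<lambda>t::real. exp (\<i> * of_real (t\<^sup>2)))"
  define G where "G = (\<lambda>t::real. f t / (2 * \<i> * of_real t))"
  define g where "g = (\<lambda>t::real. f t / (2 * \<i> * of_real (t\<^sup>2)))"
  have nf: "norm (f t) = 1" for t by (simp add: f_def norm_exp_eq_Re)
  have cf: "continuous_on S f" for S unfolding f_def by (intro continuous_intros)
  have dG: "(G has_vector_derivative (f t - g t)) (at t within S)" if "t < 0" for t S
  proof -
    have "((\<lambda>w. exp (\<i> * w\<^sup>2) / (2 * \<i> * w)) has_field_derivative
        (exp (\<i> * (of_real t)\<^sup>2) - exp (\<i> * (of_real t)\<^sup>2) / (2 * \<i> * (of_real t)\<^sup>2)))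
        (at (complex_of_real t))"
      using that by (auto intro!: derivative_eq_intros simp: field_simps power2_eq_square)
    from has_vector_derivative_real_field[OF this] show ?thesis
      by (simp add: G_def f_def g_def)
  qed
  have g: "g integrable_on {..- 1}"
  proof (rule measurable_bounded_by_integrable_imp_integrable)
    have "continuous_on {..- 1} g"
      unfolding g_def by (intro continuous_intros cf) auto
    then show "g \<in> borel_measurable (lebesgue_on {..- 1})"
      by (rule continuous_imp_measurable_on_sets_lebesgue) auto
    have "((\<lambda>R. integral {R..- 1} (\<lambda>t::real. 1 / t\<^sup>2)) \<longlongrightarrow> 1) at_bot"
    proof (rule Lim_transform_eventually)
      show "((\<lambda>R::real. 1 + 1 / R) \<longlongrightarrow> 1) at_bot" by real_asymp
      have "((\<lambda>t::real. 1 / t\<^sup>2) has_integral (- (1 / (- 1)) - (- (1 / R)))) {R..- 1}"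
        if "R \<le> - 1" for R
        using that
        by (intro fundamental_theorem_of_calculus)
           (auto intro!: derivative_eq_intros
              simp: power2_eq_square simp flip: has_real_derivative_iff_has_vector_derivative)
      then have "1 + 1 / R = integral {R..- 1} (\<lambda>t::real. 1 / t\<^sup>2)" if "R \<le> - 1" for R
        using that by (fastforce dest: integral_unique)
      then show "\<forall>\<^sub>F R in at_bot. 1 + 1 / R = integral {R..- 1} (\<lambda>t::real. 1 / t\<^sup>2)"
        by (auto simp: eventually_at_bot_linorder)
    qed
    moreover have "(\<lambda>t::real. 1 / t\<^sup>2) integrable_on {R..- 1}" for R
      by (intro integrable_continuous_real continuous_intros) auto
    ultimately show "(\<lambda>t::real. 1 / t\<^sup>2) integrable_on {..- 1}"
      using has_integral_atMost_iff_tendsto[of "\<lambda>t::real. 1 / t\<^sup>2" "- 1" 1] by blast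
    show "norm (g t) \<le> 1 / t\<^sup>2" if "t \<in> {..- 1}" for t
      using that by (simp add: g_def norm_divide norm_mult norm_power nf divide_simps)
  qed auto
  have Glim: "(G \<longlongrightarrow> 0) at_bot"
  proof (rule tendsto_norm_zero_cancel)
    show "((\<lambda>t. norm (G t)) \<longlongrightarrow> 0) at_bot"
      unfolding G_def norm_divide norm_mult nf norm_of_real by simp real_asymp
  qed
  have ftc: "((\<lambda>t. f t - g t) has_integral (G (- 1) - G R)) {R..- 1}" if "R \<le> - 1" for R
    using that by (intro fundamental_theorem_of_calculus dG) auto
  have "((\<lambda>t. f t - g t) has_integral (G (- 1) - 0)) {..- 1}"
  proof (subst has_integral_atMost_iff_tendsto)
    show "(\<lambda>t. f t - g t) integrable_on {R..- 1}" for R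
      using ftc[of R] by (cases "R \<le> - 1") (auto simp: integrable_on_def)
    show "((\<lambda>R. integral {R..- 1} (\<lambda>t. f t - g t)) \<longlongrightarrow> G (- 1) - 0) at_bot"
    proof (rule Lim_transform_eventually)
      show "((\<lambda>R. G (- 1) - G R) \<longlongrightarrow> G (- 1) - 0) at_bot"
        by (intro tendsto_intros Glim)
      show "\<forall>\<^sub>F R in at_bot. G (- 1) - G R = integral {R..- 1} (\<lambda>t. f t - g t)"
        using integral_unique[OF ftc, symmetric] by (auto simp: eventually_at_bot_linorder)
    qed
  qed
  then have f1: "f integrable_on {..- 1}"
    using integrable_add[OF has_integral_integrable g] by fastforce
  have fR: "f integrable_on {R..v}" for R v
    by (intro integrable_continuous_real cf)
  have "f integrable_on {..u}"
  proof -
    have "((\<lambda>R. integral {R..- 1} f) \<longlongrightarrow> integral {..- 1} f) at_bot"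
      using has_integral_atMost_iff_tendsto[OF fR] f1 by blast
    then have lim: "((\<lambda>R. integral {R..- 1} f + (integral {min (- 1) u..u} f - integral {min (- 1) u..- 1} f))
        \<longlongrightarrow> integral {..- 1} f + (integral {min (- 1) u..u} f - integral {min (- 1) u..- 1} f)) at_bot"
      by (intro tendsto_intros)
    have "integral {R..- 1} f + (integral {min (- 1) u..u} f - integral {min (- 1) u..- 1} f) = integral {R..u} f"
      if "R \<le> min (- 1) u" for R
    proof -
      have "integral {R..min (- 1) u} f + integral {min (- 1) u..v} f = integral {R..v} f"
        if "min (- 1) u \<le> v" for v
        using \<open>R \<le> min (- 1) u\<close> that fR
        by (rule Henstock_Kurzweil_Integration.integral_combine)
      from this[of u, symmetric] this[of "- 1", symmetric] show ?thesis by simp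
    qed
    then have "((\<lambda>R. integral {R..u} f)
        \<longlongrightarrow> integral {..- 1} f + (integral {min (- 1) u..u} f - integral {min (- 1) u..- 1} f)) at_bot"
      by (intro Lim_transform_eventually[OF lim]) (auto simp: eventually_at_bot_linorder intro!: exI[of _ "min (- 1) u"])
    then show ?thesis
      using has_integral_atMost_iff_tendsto[OF fR] by blast
  qed
  then show ?thesis by (simp add: f_def)
qed

end

theory Submission
  imports Defs "HOL-Probability.Distributions"
begin

text \<open>
  Put \<open>q = exp (- \<i> \<pi> / 4)\<close> and \<open>y = q z / 2\<close>. For \<open>a = 4\<close> the Bessel argument is \<open>z\<^sup>2 / 2\<close>, and
  since \<open>q ^ 4 = - 1\<close> the phase \<open>q ^ k\<close> turns \<open>J\<close> into a modified Bessel function: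
  \<open>q ^ k J_{k/2}(z\<^sup>2 / 2) = I_{k/2}(2 y\<^sup>2)\<close>. Write \<open>I_k\<close> for the right-hand side; it is \<open>y ^ k\<close> times
  an entire function of \<open>y ^ 4\<close>. The kernel becomes \<open>G(y) = I_0(y) + 2 \<Sum>k\<ge>1. cos (k \<theta>) I_k(y)\<close>,
  an entire function of \<open>y\<close>.
  
  The Bessel recurrences give \<open>I_k' = 2 y (I_{k-2} + I_{k+2})\<close> for \<open>k \<ge> 2\<close>. A shift of the order
  by 2 in the cosine series costs a factor \<open>cos (2 \<theta>)\<close>, because
  \<open>cos ((k+2) \<theta>) + cos ((k-2) \<theta>) = 2 cos (2 \<theta>) cos (k \<theta>)\<close>. Hence
  \<open>G' = 4 y cos (2 \<theta>) G + 4 cos \<theta> exp (- 2 y\<^sup>2) / sqrt \<pi>\<close>. The inhomogeneous term is the boundary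
  term at \<open>k = 1\<close>, which contains the elementary functions of order \<open>\<plusminus> 1/2\<close>. Solving this linear
  equation with \<open>G(0) = 1\<close> gives \<open>G(y) = exp (2 y\<^sup>2 cos (2 \<theta>)) (1 + erf (2 y cos \<theta>))\<close>, which
  is the first formula.
  
  The rest concerns \<open>erf (q u)\<close> for real \<open>u\<close>. Its derivative is a multiple of \<open>exp (\<i> u\<^sup>2)\<close>, and it
  tends to 1 as \<open>u\<close> tends to infinity, by comparison with the Gaussian integral along a vertical
  segment. This yields the integral formula and the limit of \<open>\<bar>K\<bar>\<close>. Since \<open>\<bar>K\<bar> = \<bar>1 + erf (q u)\<bar>\<close> with
  \<open>u = z \<xi>\<close>, the uniform bound reduces to \<open>\<bar>erf (q u)\<bar> \<le> 2 sqrt (2 / \<pi>)\<close>. For \<open>0 \<le> u \<le> sqrt 2\<close> this is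
  the trivial estimate of the integral; for larger \<open>u\<close> two integrations by parts show that
  \<open>erf (q u)\<close> is close enough to 1.
\<close>

section \<open>Bessel--Clifford functions\<close>

text \<open>
  The Bessel--Clifford function is the entire factor shared by the Bessel functions:
  \<open>J_s(x) = (x/2)^s C_s(- x\<^sup>2/4)\<close> and \<open>I_s(x) = (x/2)^s C_s(x\<^sup>2/4)\<close>. The reciprocal Gamma function
  keeps the coefficients meaningful at the poles of Gamma, which occur when \<open>s\<close> is a negative
  integer.
\<close>

definition bessel_clifford_coeff :: "real \<Rightarrow> nat \<Rightarrow> complex" where
  "bessel_clifford_coeff s m = of_real (rGamma (real m + s + 1) / fact m)"

definition bessel_clifford :: "real \<Rightarrow> complex \<Rightarrow> complex" where
  "bessel_clifford s u = (\<Sum>m. bessel_clifford_coeff s m * u ^ m)"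

lemma diffs_bessel_clifford_coeff:
  "diffs (bessel_clifford_coeff s) = bessel_clifford_coeff (s + 1)"
proof
  fix m
  have "diffs (bessel_clifford_coeff s) m = of_real (real (Suc m) * (rGamma (real (Suc m) + s + 1) / fact (Suc m)))"
    by (simp only: diffs_def bessel_clifford_coeff_def of_real_mult of_real_of_nat_eq)
  also have "real (Suc m) * (rGamma (real (Suc m) + s + 1) / fact (Suc m)) = rGamma (real m + (s + 1) + 1) / fact m"
    by (simp add: field_simps del: of_nat_Suc) (simp add: algebra_simps)
  finally show "diffs (bessel_clifford_coeff s) m = bessel_clifford_coeff (s + 1) m"
    by (simp only: bessel_clifford_coeff_def[of "s + 1" m])
qed

text \<open>
  Since \<open>Gamma (m + s + 1) \<ge> Gamma (s + 1)\<close>, the exponential series is a majorant. The factor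
  \<open>1 / Gamma (s + 1)\<close> in the bound is what makes series over the order \<open>s\<close> converge.
\<close>

lemma
  assumes "s \<ge> 0"
  shows summable_bessel_clifford_nonneg: "summable (\<lambda>m. bessel_clifford_coeff s m * u ^ m)"
    and norm_bessel_clifford_le: "norm (bessel_clifford s u) \<le> exp (norm u) / Gamma (s + 1)"
proof -
  let ?f = "\<lambda>m. bessel_clifford_coeff s m * u ^ m"
  let ?g = "\<lambda>m. rGamma (s + 1) * (norm u ^ m /\<^sub>R fact m)"
  have le: "norm (?f m) \<le> ?g m" for m
  proof -
    have pos: "Gamma (s + 1) > 0" "Gamma (real m + s + 1) > 0"
      using assms by (auto intro!: Gamma_real_pos)
    have "rGamma (real m + s + 1) \<le> rGamma (s + 1)"
      using Gamma_shift_ge[OF assms, of m] pos by (simp add: rGamma_inverse_Gamma le_imp_inverse_le)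
    moreover have "rGamma (real m + s + 1) \<ge> 0"
      using pos by (simp add: rGamma_inverse_Gamma)
    ultimately have "norm (bessel_clifford_coeff s m) \<le> rGamma (s + 1) / fact m"
      unfolding bessel_clifford_coeff_def norm_of_real by (simp add: divide_right_mono)
    from mult_right_mono[OF this, of "norm u ^ m"] show ?thesis
      by (simp add: norm_mult norm_power divide_inverse mult_ac)
  qed
  have g: "?g sums (rGamma (s + 1) * exp (norm u))"
    by (intro sums_mult exp_converges)
  show "summable ?f"
    by (rule summable_comparison_test'[OF sums_summable[OF g]]) (use le in auto)
  have sn: "summable (\<lambda>m. norm (?f m))"
    by (rule summable_comparison_test'[OF sums_summable[OF g]]) (use le in auto)
  have "norm (suminf ?f) \<le> (\<Sum>m. norm (?f m))"
    by (rule summable_norm[OF sn])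
  also have "\<dots> \<le> suminf ?g"
    by (rule suminf_le[OF le sn sums_summable[OF g]])
  also have "\<dots> = rGamma (s + 1) * exp (norm u)"
    using g by (rule sums_unique[symmetric])
  finally show "norm (bessel_clifford s u) \<le> exp (norm u) / Gamma (s + 1)"
    by (simp add: bessel_clifford_def rGamma_inverse_Gamma field_simps)
qed

text \<open>
  By \<open>(m + s) rGamma (m + s + 1) = rGamma (m + s)\<close>, lowering the order multiplies the coefficients
  by \<open>m + s\<close>; the factor \<open>m\<close> acts as \<open>u d/du\<close>, and differentiation raises the order by 1. The
  hypothesis is summability for the order \<open>s\<close> only, so the lemma also transports convergence from
  \<open>s\<close> to \<open>s - 1\<close>.
\<close>

lemma bessel_clifford_contiguous_sums:
  assumes "\<And>u. summable (\<lambda>m. bessel_clifford_coeff s m * u ^ m)"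
  shows "(\<lambda>m. bessel_clifford_coeff (s - 1) m * u ^ m) sums
           (of_real s * bessel_clifford s u + u * bessel_clifford (s + 1) u)"
proof -
  let ?c = "bessel_clifford_coeff s"
  have 1: "(\<lambda>m. of_real s * (?c m * u ^ m)) sums (of_real s * bessel_clifford s u)"
    unfolding bessel_clifford_def by (intro sums_mult summable_sums assms)
  have "(\<lambda>m. u * (diffs ?c m * u ^ m)) sums (u * bessel_clifford (s + 1) u)"
    unfolding bessel_clifford_def diffs_bessel_clifford_coeff[symmetric]
    by (intro sums_mult summable_sums termdiff_converges_all assms)
  then have "(\<lambda>m. of_nat (Suc m) * ?c (Suc m) * u ^ Suc m) sums (u * bessel_clifford (s + 1) u)"
    by (simp add: diffs_def mult_ac)
  then have 2: "(\<lambda>m. of_nat m * ?c m * u ^ m) sums (u * bessel_clifford (s + 1) u)"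
    by (subst (asm) sums_Suc_iff) simp
  have "bessel_clifford_coeff (s - 1) m = (of_real s + of_nat m) * ?c m" for m
  proof -
    have "rGamma (real m + s) = (s + real m) * rGamma (real m + s + 1)"
      using rGamma_plus1[of "real m + s"] by (simp add: add.commute)
    then have "rGamma (real m + (s - 1) + 1) / fact m = (s + real m) * (rGamma (real m + s + 1) / fact m)"
      by simp
    then show ?thesis
      unfolding bessel_clifford_coeff_def by (simp only: of_real_mult of_real_add of_real_of_nat_eq)
  qed
  then show ?thesis
    using sums_add[OF 1 2] by (simp add: algebra_simps)
qed

lemma summable_bessel_clifford:
  assumes "s \<ge> -1"
  shows "summable (\<lambda>m. bessel_clifford_coeff s m * u ^ m)"
  using sums_summable[OF bessel_clifford_contiguous_sums[OF summable_bessel_clifford_nonneg, of "s + 1"]] assms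
  by simp

lemma bessel_clifford_contiguous:
  assumes "s \<ge> 0"
  shows "bessel_clifford (s - 1) u = of_real s * bessel_clifford s u + u * bessel_clifford (s + 1) u"
  using sums_unique[OF bessel_clifford_contiguous_sums[OF summable_bessel_clifford_nonneg[OF assms]]]
  by (simp add: bessel_clifford_def)

lemma DERIV_bessel_clifford:
  assumes "s \<ge> -1"
  shows "(bessel_clifford s has_field_derivative bessel_clifford (s + 1) u) (at u)"
  using termdiffs_strong_converges_everywhere[OF summable_bessel_clifford[OF assms]]
  by (simp add: bessel_clifford_def[abs_def] diffs_bessel_clifford_coeff)

lemma DERIV_bessel_clifford_chain [derivative_intros]:
  assumes "s \<ge> -1" "(f has_field_derivative f') (at x within A)"
  shows "((\<lambda>x. bessel_clifford s (f x)) has_field_derivative bessel_clifford (s + 1) (f x) * f') (at x within A)"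
  using DERIV_chain2[OF DERIV_bessel_clifford[OF assms(1)] assms(2)] .

lemma bessel_J_eq_bessel_clifford:
  assumes "x > 0" "\<nu> \<ge> 0"
  shows "complex_of_real (bessel_J \<nu> x) = of_real ((x / 2) powr \<nu>) * bessel_clifford \<nu> (- of_real ((x / 2)\<^sup>2))"
proof -
  have "(\<lambda>m. complex_of_real ((- 1) ^ m / (fact m * Gamma (real m + \<nu> + 1)) * (x / 2) powr (2 * real m + \<nu>))) sums
        complex_of_real (bessel_J \<nu> x)"
    unfolding bessel_J_def
    by (intro sums_of_real summable_sums bessel_J_terms(1) assms)
  moreover have "complex_of_real ((- 1) ^ m / (fact m * Gamma (real m + \<nu> + 1)) * (x / 2) powr (2 * real m + \<nu>)) =
     of_real ((x / 2) powr \<nu>) * (bessel_clifford_coeff \<nu> m * (- of_real ((x / 2)\<^sup>2)) ^ m)" for m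
  proof -
    have "(x / 2) powr (2 * real m) = (x / 2) powr real (2 * m)" by simp
    also have "\<dots> = (x / 2) ^ (2 * m)" using assms by (subst powr_realpow) auto
    finally have split: "(x / 2) powr (2 * real m + \<nu>) = (x / 2) powr \<nu> * ((x / 2)\<^sup>2) ^ m"
      by (simp only: powr_add power_mult mult.commute[of _ "(x / 2) powr \<nu>"])
    have sign: "(- ((x / 2)\<^sup>2)) ^ m = (- 1) ^ m * ((x / 2)\<^sup>2) ^ m"
      by (rule power_minus)
    have "(- 1) ^ m / (fact m * Gamma (real m + \<nu> + 1)) * (x / 2) powr (2 * real m + \<nu>) =
        (x / 2) powr \<nu> * ((rGamma (real m + \<nu> + 1) / fact m) * (- ((x / 2)\<^sup>2)) ^ m)"
      unfolding split sign rGamma_inverse_Gamma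
      by (simp only: divide_inverse inverse_mult_distrib mult_ac)
    then show ?thesis
      by (simp only: bessel_clifford_coeff_def of_real_mult of_real_power of_real_minus)
  qed
  ultimately have "(\<lambda>m. of_real ((x / 2) powr \<nu>) * (bessel_clifford_coeff \<nu> m * (- of_real ((x / 2)\<^sup>2)) ^ m))
    sums complex_of_real (bessel_J \<nu> x)" by (simp only:)
  moreover have "(\<lambda>m. of_real ((x / 2) powr \<nu>) * (bessel_clifford_coeff \<nu> m * (- of_real ((x / 2)\<^sup>2)) ^ m))
    sums (of_real ((x / 2) powr \<nu>) * bessel_clifford \<nu> (- of_real ((x / 2)\<^sup>2)))"
    unfolding bessel_clifford_def by (intro sums_mult summable_sums summable_bessel_clifford_nonneg assms)
  ultimately show ?thesis by (rule sums_unique2)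
qed

lemma bessel_clifford_0: "bessel_clifford s 0 = of_real (rGamma (s + 1))"
  unfolding bessel_clifford_def powser_zero by (simp add: bessel_clifford_coeff_def)

text \<open>
  The two terms on the left are \<open>cosh (2 y\<^sup>2) / sqrt \<pi>\<close> and \<open>sinh (2 y\<^sup>2) / sqrt \<pi>\<close>. Only their
  difference matters here, and the recurrences say that it satisfies \<open>E' = - 4 y E\<close>, which avoids
  a comparison of power series.
\<close>

lemma bessel_clifford_half_orders:
  "bessel_clifford (- 1 / 2) (y ^ 4) - y\<^sup>2 * bessel_clifford (1 / 2) (y ^ 4)
     = exp (- 2 * y\<^sup>2) / of_real (sqrt pi)"
proof -
  define E where "E = (\<lambda>y. exp (2 * y\<^sup>2) * (bessel_clifford (- 1 / 2) (y ^ 4) - y\<^sup>2 * bessel_clifford (1 / 2) (y ^ 4)))"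
  have "(E has_field_derivative 0) (at y)" for y
  proof -
    have c: "bessel_clifford (- (1 / 2)) (y ^ 4) =
        (1 / 2) * bessel_clifford (1 / 2) (y ^ 4) + y ^ 4 * bessel_clifford (3 / 2) (y ^ 4)"
      using bessel_clifford_contiguous[of "1 / 2" "y ^ 4"] by simp
    show ?thesis unfolding E_def
      by (rule derivative_eq_intros refl | simp)+
        (simp add: c, simp add: algebra_simps power2_eq_square power3_eq_cube power4_eq_xxxx)
  qed
  then have "\<exists>c. \<forall>x\<in>UNIV. E x = c"
    by (intro has_field_derivative_zero_constant) auto
  then have "E y = E 0" by auto
  moreover have "E 0 = 1 / of_real (sqrt pi)"
    by (simp add: E_def bessel_clifford_0 rGamma_inverse_Gamma Gamma_one_half_real field_simps)
  ultimately show ?thesis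
    by (simp add: E_def exp_minus field_simps)
qed

section \<open>Modified Bessel functions of half-integral order and their cosine series\<close>

text \<open>
  For \<open>y > 0\<close> this is the modified Bessel function \<open>I_{k/2}(2 y\<^sup>2)\<close>. In the variable \<open>y\<close> it is entire
  for every \<open>k\<close>, and no branch of a square root has to be chosen when \<open>y\<close> is rotated.
\<close>

definition half_order_I :: "nat \<Rightarrow> complex \<Rightarrow> complex" where
  "half_order_I k y = y ^ k * bessel_clifford (real k / 2) (y ^ 4)"

definition half_order_I' :: "nat \<Rightarrow> complex \<Rightarrow> complex" where
  "half_order_I' k y = of_nat k * y ^ (k - 1) * bessel_clifford (real k / 2) (y ^ 4)
     + 4 * y ^ (k + 3) * bessel_clifford (real k / 2 + 1) (y ^ 4)"

lemma DERIV_half_order_I: "(half_order_I k has_field_derivative half_order_I' k y) (at y)"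
  unfolding half_order_I_def[abs_def] half_order_I'_def
  by (rule derivative_eq_intros refl | simp)+ (simp add: power_add algebra_simps)

text \<open>
  These three identities are \<open>2 I_\<nu>' = I_{\<nu>-1} + I_{\<nu>+1}\<close> in the variable \<open>y\<close>. The general pattern
  is \<open>half_order_I'_add_2\<close>. At \<open>k = 0\<close> it takes the order \<open>- 1\<close> to the order 1, and at \<open>k = 1\<close> the
  order \<open>- 1/2\<close> survives and has no counterpart among the functions of the series.
\<close>

lemma half_order_I'_0: "half_order_I' 0 y = 4 * y * half_order_I 2 y"
  by (simp add: half_order_I'_def half_order_I_def power2_eq_square power3_eq_cube)

lemma half_order_I'_1:
  "half_order_I' 1 y = 2 * bessel_clifford (- 1 / 2) (y ^ 4) + 2 * y * half_order_I 3 y"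
  using bessel_clifford_contiguous[of "1 / 2" "y ^ 4"]
  by (simp add: half_order_I'_def half_order_I_def algebra_simps power4_eq_xxxx power3_eq_cube)

lemma half_order_I'_add_2:
  "half_order_I' (k + 2) y = 2 * y * (half_order_I k y + half_order_I (k + 4) y)"
proof -
  have "bessel_clifford (real k / 2) (y ^ 4) =
     of_real (real k / 2 + 1) * bessel_clifford (real k / 2 + 1) (y ^ 4)
       + y ^ 4 * bessel_clifford (real k / 2 + 2) (y ^ 4)"
    using bessel_clifford_contiguous[of "real k / 2 + 1" "y ^ 4"] by (simp add: add.commute)
  moreover have "real (k + 2) / 2 = real k / 2 + 1" "real (k + 4) / 2 = real k / 2 + 2"
    "real k / 2 + 1 + 1 = real k / 2 + 2"
    by simp_all
  ultimately show ?thesis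
    unfolding half_order_I'_def half_order_I_def
    by (simp only:) (simp add: power_add algebra_simps eval_nat_numeral)
qed

text \<open>
  Locally uniform geometric decay in \<open>k\<close>, from \<open>Gamma (s + 1) \<ge> T powr s * exp (- T)\<close>. The choice
  \<open>T = 4 R\<^sup>2\<close> turns \<open>R ^ k / T powr (k / 2)\<close> into \<open>(1 / 2) ^ k\<close>.
\<close>

lemma norm_half_order_I_le:
  assumes "norm y \<le> R" "R > 0"
  shows "norm (half_order_I k y) \<le> exp (R ^ 4 + 4 * R\<^sup>2) * (1 / 2) ^ k"
proof -
  have pos: "Gamma (real k / 2 + 1) > 0"
    by (intro Gamma_real_pos) auto
  have T: "(4 * R\<^sup>2) powr (real k / 2) = (2 * R) ^ k"
  proof -
    have "(4 * R\<^sup>2) powr (real k / 2) = ((2 * R) powr 2) powr (real k / 2)"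
      using assms by (simp add: power_mult_distrib)
    also have "\<dots> = (2 * R) ^ k"
      using assms by (simp only: powr_powr) (simp add: powr_realpow)
    finally show ?thesis .
  qed
  have G: "(2 * R) ^ k * exp (- (4 * R\<^sup>2)) \<le> Gamma (real k / 2 + 1)"
    using Gamma_ge_powr[of "real k / 2" "4 * R\<^sup>2"] assms by (simp add: T)
  have "norm (half_order_I k y) = norm y ^ k * norm (bessel_clifford (real k / 2) (y ^ 4))"
    by (simp add: half_order_I_def norm_mult norm_power)
  also have "\<dots> \<le> R ^ k * (exp (norm (y ^ 4)) / Gamma (real k / 2 + 1))"
    using assms by (intro mult_mono power_mono norm_bessel_clifford_le) auto
  also have "\<dots> \<le> R ^ k * (exp (R ^ 4) / ((2 * R) ^ k * exp (- (4 * R\<^sup>2))))"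
    using assms G pos
    by (intro mult_left_mono frac_le) (auto simp: norm_power intro!: power_mono)
  also have "\<dots> = exp (R ^ 4 + 4 * R\<^sup>2) * (1 / 2) ^ k"
    using assms by (simp add: exp_minus exp_add power_mult_distrib power_divide field_simps)
  finally show ?thesis .
qed

lemma summable_bounded_mult_half_order_I:
  assumes "\<And>k. norm (c k) \<le> (1::real)"
  shows "summable (\<lambda>k. of_real (c k) * half_order_I k y)"
proof (rule summable_comparison_test')
  let ?R = "norm y + 1"
  show "summable (\<lambda>k. exp (?R ^ 4 + 4 * ?R\<^sup>2) * (1 / 2) ^ k)"
    by (intro summable_mult summable_geometric) simp
  show "norm (of_real (c k) * half_order_I k y) \<le> exp (?R ^ 4 + 4 * ?R\<^sup>2) * (1 / 2) ^ k" for k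
  proof -
    have "norm (of_real (c k) * half_order_I k y) \<le> norm (half_order_I k y)"
      using assms[of k] by (simp add: norm_mult mult_left_le_one_le)
    also have "\<dots> \<le> exp (?R ^ 4 + 4 * ?R\<^sup>2) * (1 / 2) ^ k"
      by (intro norm_half_order_I_le) (auto intro: add_nonneg_pos)
    finally show ?thesis .
  qed
qed

text \<open>
  The recurrences shift the order up and down by 2. Moving the shifts from the functions to the
  cosines gives \<open>cos ((k+2) \<theta>) + cos ((k-2) \<theta>) = 2 cos (2 \<theta>) cos (k \<theta>)\<close> and thus the
  multiple of \<open>W\<close>; the remaining terms come from the first few indices. Of these, the order \<open>- 1/2\<close>
  and the order \<open>1/2\<close> combine into the Gaussian.
\<close>

lemma cosine_series_derivative_sums:
  fixes y :: complex and \<theta> :: real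
  defines "W \<equiv> (\<Sum>k. of_real (cos (real k * \<theta>)) * half_order_I k y)"
  shows "(\<lambda>k. of_real (cos (real k * \<theta>)) * half_order_I' k y) sums
           (4 * y * of_real (cos (2 * \<theta>)) * W + 2 * of_real (cos \<theta>) * exp (- 2 * y\<^sup>2) / of_real (sqrt pi)
            + 2 * y * half_order_I 2 y - 2 * y * of_real (cos (2 * \<theta>)) * half_order_I 0 y)"
proof -
  \<comment> \<open>Integer indices let the cosine be shifted below 0, where \<open>c (- n) = c n\<close>.\<close>
  define c where "c n = complex_of_real (cos (real_of_int n * \<theta>))" for n
  let ?I = "\<lambda>k. half_order_I k y"
  have sm: "summable (\<lambda>k. c (int k + a) * ?I k)" for a
    unfolding c_def by (intro summable_bounded_mult_half_order_I) auto
  have W: "(\<lambda>k. c (int k) * ?I k) sums W"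
    using summable_sums[OF sm[of 0]] by (simp add: W_def c_def)
  have prod: "c (int k + 2) + c (int k - 2) = 2 * c 2 * c (int k)" for k
  proof -
    have "cos (real_of_int (int k + 2) * \<theta>) + cos (real_of_int (int k - 2) * \<theta>)
        = 2 * cos (2 * \<theta>) * cos (real k * \<theta>)"
      by (simp add: distrib_right left_diff_distrib cos_add cos_diff)
    from arg_cong[OF this, of complex_of_real] show ?thesis
      by (simp add: c_def)
  qed
  define U V where "U = (\<Sum>k. c (int k + 2) * ?I k)" and "V = (\<Sum>k. c (int k - 2) * ?I k)"
  have U: "(\<lambda>k. c (int k + 2) * ?I k) sums U"
    unfolding U_def by (intro summable_sums sm)
  have V: "(\<lambda>k. c (int k - 2) * ?I k) sums V"
    unfolding V_def using summable_sums[OF sm[of "- 2"]] by simp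
  have "(\<lambda>k. c (int k + 2) * ?I k + c (int k - 2) * ?I k) sums (U + V)"
    by (intro sums_add U V)
  also have "(\<lambda>k. c (int k + 2) * ?I k + c (int k - 2) * ?I k) = (\<lambda>k. 2 * c 2 * (c (int k) * ?I k))"
    by (simp add: prod mult.assoc flip: distrib_right)
  finally have UV: "U + V = 2 * c 2 * W"
    using sums_unique2 sums_mult[OF W] by blast
  (* dropping k < 4 from V, whose cosines are c (-2), c (-1), c 0, c 1 *)
  have V4: "(\<lambda>k. c (int k + 2) * ?I (k + 4)) sums (V - (c 2 * ?I 0 + c 1 * ?I 1 + ?I 2 + c 1 * ?I 3))"
  proof -
    have "(\<Sum>k<4. c (int k - 2) * ?I k) = c 2 * ?I 0 + c 1 * ?I 1 + ?I 2 + c 1 * ?I 3"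
      by (simp add: eval_nat_numeral c_def)
    then show ?thesis
      using V sums_iff_shift[of "\<lambda>k. c (int k - 2) * ?I k" 4] by (simp add: algebra_simps)
  qed
  have "(\<lambda>k. 2 * y * (c (int k + 2) * ?I k + c (int k + 2) * ?I (k + 4))) sums
          (2 * y * (U + (V - (c 2 * ?I 0 + c 1 * ?I 1 + ?I 2 + c 1 * ?I 3))))"
    by (intro sums_mult sums_add U V4)
  then have "(\<lambda>k. c (int (k + 2)) * half_order_I' (k + 2) y) sums
          (2 * y * (U + (V - (c 2 * ?I 0 + c 1 * ?I 1 + ?I 2 + c 1 * ?I 3))))"
    by (simp only: half_order_I'_add_2) (simp add: algebra_simps)
  then have total: "(\<lambda>k. c (int k) * half_order_I' k y) sums
          (2 * y * (U + (V - (c 2 * ?I 0 + c 1 * ?I 1 + ?I 2 + c 1 * ?I 3)))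
            + (\<Sum>k<2. c (int k) * half_order_I' k y))"
    by (simp only: sums_iff_shift' flip: sums_iff_shift)
  have head: "(\<Sum>k<2. c (int k) * half_order_I' k y)
      = 4 * y * ?I 2 + c 1 * (2 * bessel_clifford (- 1 / 2) (y ^ 4) + 2 * y * ?I 3)"
  proof -
    have "(\<Sum>k<2. c (int k) * half_order_I' k y) = half_order_I' 0 y + c 1 * half_order_I' 1 y"
      by (simp add: eval_nat_numeral c_def)
    then show ?thesis by (simp only: half_order_I'_0 half_order_I'_1)
  qed
  have order: "bessel_clifford (- 1 / 2) (y ^ 4) = y * ?I 1 + exp (- 2 * y\<^sup>2) / of_real (sqrt pi)"
    using bessel_clifford_half_orders[of y] by (simp add: half_order_I_def power2_eq_square algebra_simps)
  have "U + (V - (c 2 * ?I 0 + c 1 * ?I 1 + ?I 2 + c 1 * ?I 3))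
       = 2 * c 2 * W - (c 2 * ?I 0 + c 1 * ?I 1 + ?I 2 + c 1 * ?I 3)"
    by (simp flip: UV)
  with total have "(\<lambda>k. c (int k) * half_order_I' k y) sums
     (4 * y * c 2 * W + 2 * c 1 * exp (- 2 * y\<^sup>2) / of_real (sqrt pi) + 2 * y * ?I 2 - 2 * y * c 2 * ?I 0)"
    by (simp only: head order) (simp add: algebra_simps)
  then show ?thesis by (simp add: c_def)
qed

lemma DERIV_cosine_series:
  "((\<lambda>y. \<Sum>k. of_real (cos (real k * \<theta>)) * half_order_I k y) has_field_derivative
     (\<Sum>k. of_real (cos (real k * \<theta>)) * half_order_I' k y)) (at y)"
proof -
  let ?f = "\<lambda>k y. complex_of_real (cos (real k * \<theta>)) * half_order_I k y"
  let ?f' = "\<lambda>k y. complex_of_real (cos (real k * \<theta>)) * half_order_I' k y"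
  have "\<exists>g g'. \<forall>x\<in>UNIV. ((\<lambda>n. ?f n x) sums g x) \<and> ((\<lambda>n. ?f' n x) sums g' x) \<and>
      (g has_field_derivative g' x) (at x)"
  proof (rule series_and_derivative_comparison_complex)
    show "(?f n has_field_derivative ?f' n x) (at x)" for n x
      by (intro DERIV_cmult DERIV_half_order_I)
    fix x :: complex
    let ?R = "norm x + 1"
    let ?h = "\<lambda>k. complex_of_real (exp (?R ^ 4 + 4 * ?R\<^sup>2) * (1 / 2) ^ k)"
    have "summable (\<lambda>k. exp (?R ^ 4 + 4 * ?R\<^sup>2) * (1 / 2) ^ k)"
      by (intro summable_mult summable_geometric) simp
    then have "summable ?h" by (simp only: summable_of_real)
    moreover have "range ?h \<subseteq> \<real>\<^sub>\<ge>\<^sub>0"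
      by (auto simp only: nonneg_Reals_of_real_iff image_subset_iff) simp
    moreover have "cmod (?f n y) \<le> cmod (?h n)" if "y \<in> ball x 1 \<inter> UNIV" for n y
    proof -
      have "norm y \<le> ?R"
        using that norm_triangle_ineq2[of y x] by (simp add: dist_norm norm_minus_commute)
      have "cmod (?f n y) \<le> norm (half_order_I n y)"
        by (simp add: norm_mult mult_left_le_one_le)
      also have "\<dots> \<le> exp (?R ^ 4 + 4 * ?R\<^sup>2) * (1 / 2) ^ n"
        using \<open>norm y \<le> ?R\<close> by (intro norm_half_order_I_le) (auto intro: add_nonneg_pos)
      also have "\<dots> = cmod (?h n)"
        unfolding norm_of_real by simp
      finally show ?thesis .
    qed
    ultimately show "\<exists>d h. 0 < d \<and> summable h \<and> range h \<subseteq> \<real>\<^sub>\<ge>\<^sub>0 \<and>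
        (\<forall>\<^sub>F n in sequentially. \<forall>y\<in>ball x d \<inter> UNIV. cmod (?f n y) \<le> cmod (h n))"
      by (intro exI[of _ 1] exI[of _ ?h] conjI always_eventually allI ballI) auto
  qed auto
  then obtain g g' where g: "\<And>x. (\<lambda>n. ?f n x) sums g x" "\<And>x. (\<lambda>n. ?f' n x) sums g' x"
      "\<And>x. (g has_field_derivative g' x) (at x)" by blast
  have "(\<lambda>y. \<Sum>k. ?f k y) = g" "(\<Sum>k. ?f' k y) = g' y"
    using g(1,2) by (auto simp: sums_iff)
  with g(3) show ?thesis by simp
qed

section \<open>The error function on the real axis and on the ray at angle \<open>- \<pi> / 4\<close>\<close>

lemma DERIV_erf: "(erf has_field_derivative 2 / of_real (sqrt pi) * exp (- w\<^sup>2)) (at w)"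
proof -
  have "(\<lambda>w::complex. exp (- w\<^sup>2)) holomorphic_on UNIV"
    by (intro holomorphic_intros)
  from holomorphic_convex_primitive'[OF convex_UNIV open_UNIV this]
  obtain F where F: "\<And>w::complex. (F has_field_derivative exp (- w\<^sup>2)) (at w)"
    by auto
  have "contour_integral (linepath 0 w) (\<lambda>t. exp (- t\<^sup>2)) = F w - F 0" for w
    using contour_integral_primitive[of UNIV F "\<lambda>t. exp (- t\<^sup>2)" "linepath 0 w"] F
    by (intro contour_integral_unique) (auto intro: has_field_derivative_at_within)
  then have "erf = (\<lambda>w. 2 / of_real (sqrt pi) * (F w - F 0))"
    by (auto simp: erf_def)
  moreover have "((\<lambda>w. 2 / of_real (sqrt pi) * (F w - F 0)) has_field_derivative
      2 / of_real (sqrt pi) * (exp (- w\<^sup>2) - 0)) (at w)"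
    by (intro DERIV_cmult DERIV_diff F DERIV_const)
  ultimately show ?thesis by simp
qed

lemma DERIV_erf_chain [derivative_intros]:
  assumes "(f has_field_derivative f') (at x within A)"
  shows "((\<lambda>x. erf (f x)) has_field_derivative 2 / of_real (sqrt pi) * exp (- (f x)\<^sup>2) * f') (at x within A)"
  using DERIV_chain2[OF DERIV_erf assms] .

lemma erf_0 [simp]: "erf 0 = 0"
  by (simp add: erf_def)

lemma erf_minus [simp]: "erf (- w) = - erf w"
proof -
  have "((\<lambda>w. erf (- w) + erf w) has_field_derivative 0) (at w)" for w
    by (rule derivative_eq_intros refl | simp)+
  then have "\<exists>c. \<forall>w\<in>UNIV. erf (- w) + erf w = c"
    by (intro has_field_derivative_zero_constant) auto
  then have "erf (- w) + erf w = erf (- 0) + erf 0" by (metis UNIV_I)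
  then show ?thesis by (simp add: add_eq_0_iff2)
qed

text \<open>
  On the real axis this is the value \<open>sqrt \<pi> / 2\<close> of the Gaussian integral, carried from the Lebesgue
  integral over the half-line to the primitive \<open>erf\<close>.
\<close>

lemma erf_of_real_at_top: "((\<lambda>R. erf (of_real R)) \<longlongrightarrow> 1) at_top"
proof -
  let ?g = "\<lambda>x::real. indicator {0..} x *\<^sub>R exp (- x\<^sup>2)"
  have int: "integrable lborel ?g" and val: "(\<integral>x. ?g x \<partial>lborel) = sqrt pi / 2"
    using gaussian_moment_0 by (auto simp: has_bochner_integral_iff)
  have "((\<lambda>R. \<integral>x. indicator {..R} x *\<^sub>R ?g x \<partial>lborel) \<longlongrightarrow> sqrt pi / 2) at_top"
    using tendsto_integral_at_top[OF _ int] by (simp only: val sets_lborel)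
  then have lim: "((\<lambda>R. 2 / of_real (sqrt pi) * complex_of_real (\<integral>x. indicator {..R} x *\<^sub>R ?g x \<partial>lborel))
      \<longlongrightarrow> 2 / of_real (sqrt pi) * of_real (sqrt pi / 2)) at_top"
    by (intro tendsto_intros)
  have erf_eq: "2 / of_real (sqrt pi) * complex_of_real (\<integral>x. indicator {..R} x *\<^sub>R ?g x \<partial>lborel) = erf (of_real R)"
    if "R > 0" for R
  proof -
    have ind: "(\<lambda>x. indicator {..R} x *\<^sub>R ?g x) = (\<lambda>x. indicator {0..R} x *\<^sub>R exp (- x\<^sup>2))"
      by (auto simp: indicator_def)
    have "set_integrable lborel {0..R} (\<lambda>x::real. exp (- x\<^sup>2))"
      by (intro borel_integrable_atLeastAtMost') (intro continuous_intros)
    then have I: "(\<integral>x. indicator {..R} x *\<^sub>R ?g x \<partial>lborel) = integral {0..R} (\<lambda>x. exp (- x\<^sup>2))"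
      unfolding ind using set_borel_integral_eq_integral(2)[of "{0..R}" "\<lambda>x. exp (- x\<^sup>2)"]
      by (simp add: set_lebesgue_integral_def)
    have "((\<lambda>x::real. exp (- x\<^sup>2)) has_integral integral {0..R} (\<lambda>x. exp (- x\<^sup>2))) {0..R}"
      by (intro integrable_integral integrable_continuous_real continuous_intros)
    from has_integral_mult_right[OF has_integral_linear[OF this bounded_linear_of_real], of "2 / complex_of_real (sqrt pi)"]
    have "((\<lambda>x. 2 / of_real (sqrt pi) * exp (- (complex_of_real x)\<^sup>2)) has_integral
        2 / of_real (sqrt pi) * complex_of_real (integral {0..R} (\<lambda>x. exp (- x\<^sup>2)))) {0..R}"
      by (simp add: o_def flip: exp_of_real)
    moreover have "((\<lambda>x. 2 / of_real (sqrt pi) * exp (- (complex_of_real x)\<^sup>2)) has_integral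
        erf (of_real R) - erf (of_real 0)) {0..R}"
      using that by (intro fundamental_theorem_of_calculus has_vector_derivative_real_field DERIV_erf) auto
    ultimately have "2 / of_real (sqrt pi) * complex_of_real (integral {0..R} (\<lambda>x. exp (- x\<^sup>2)))
        = erf (of_real R) - erf (of_real 0)"
      by (rule has_integral_unique)
    then show ?thesis
      unfolding I by simp
  qed
  have "\<forall>\<^sub>F R in at_top. 2 / of_real (sqrt pi) * complex_of_real (\<integral>x. indicator {..R} x *\<^sub>R ?g x \<partial>lborel) = erf (of_real R)"
    using eventually_gt_at_top[of 0] by eventually_elim (rule erf_eq)
  from Lim_transform_eventually[OF lim this] show ?thesis by simp
qed

definition rot8 :: complex where
  "rot8 = exp (- \<i> * of_real (pi / 4))"

lemma norm_rot8 [simp]: "norm rot8 = 1"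
  by (simp add: rot8_def norm_exp_eq_Re)

lemma rot8_eq: "rot8 = (1 - \<i>) / of_real (sqrt 2)"
  by (simp add: rot8_def complex_eq_iff Re_exp Im_exp cos_45 sin_45 real_div_sqrt field_simps)

lemma rot8_square: "rot8\<^sup>2 = - \<i>"
proof -
  have "rot8\<^sup>2 = (1 - \<i>)\<^sup>2 / 2"
    by (simp add: rot8_eq power_divide flip: of_real_power)
  then show ?thesis by (simp add: power2_eq_square algebra_simps)
qed

text \<open>
  On the segment from \<open>R\<close> to \<open>R - \<i> R\<close> one has \<open>\<bar>exp (- (R - \<i> y)\<^sup>2)\<bar> = exp (y\<^sup>2 - R\<^sup>2)\<close>, and for
  \<open>0 \<le> y \<le> R\<close> this is at most \<open>exp (R (y - R))\<close>, whose integral is less than \<open>1 / R\<close>. The end point lies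
  on the ray through \<open>rot8\<close>, so the limit on the real axis passes to that ray.
\<close>

lemma erf_vertical_bound:
  assumes "R > 0"
  shows "norm (erf (of_real R - \<i> * of_real R) - erf (of_real R)) \<le> 2 / sqrt pi / R"
proof -
  let ?f = "\<lambda>y::real. erf (of_real R - \<i> * of_real y)"
  let ?\<phi> = "\<lambda>y::real. 2 / sqrt pi * exp (R * (y - R)) / R"
  have f: "(?f has_vector_derivative (2 / of_real (sqrt pi) * exp (- (of_real R - \<i> * of_real y)\<^sup>2) * (- \<i>))) (at y within A)" for y A
    by (rule has_vector_derivative_real_field) (auto intro!: derivative_eq_intros)
  have \<phi>: "(?\<phi> has_vector_derivative (2 / sqrt pi * exp (R * (y - R)))) (at y within A)" for y A
    unfolding has_real_derivative_iff_has_vector_derivative[symmetric]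
    using assms by (auto intro!: derivative_eq_intros)
  have "norm (?f R - ?f 0) \<le> ?\<phi> R - ?\<phi> 0"
  proof (rule differentiable_bound_general[OF assms _ _ f \<phi>])
    show "continuous_on {0..R} ?f" "continuous_on {0..R} ?\<phi>"
      using f \<phi> by (auto intro!: continuous_on_vector_derivative)
    fix y assume y: "0 < y" "y < R"
    have "y\<^sup>2 - R\<^sup>2 = (y - R) * (y + R)" by (simp add: power2_eq_square algebra_simps)
    also have "\<dots> \<le> R * (y - R)"
      using y by (simp add: mult.commute[of R] mult_left_mono_neg)
    finally show "norm (2 / of_real (sqrt pi) * exp (- (of_real R - \<i> * of_real y)\<^sup>2) * (- \<i>))
        \<le> 2 / sqrt pi * exp (R * (y - R))"
      by (simp add: norm_mult norm_divide norm_exp_eq_Re power2_eq_square divide_right_mono)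
  qed
  also have "\<dots> \<le> 2 / sqrt pi / R" using assms by (simp add: field_simps)
  finally show ?thesis by simp
qed

lemma erf_rot8_at_top: "((\<lambda>u. erf (rot8 * of_real u)) \<longlongrightarrow> 1) at_top"
proof -
  let ?d = "\<lambda>R. erf (of_real R - \<i> * of_real R) - erf (of_real R)"
  have "(?d \<longlongrightarrow> 0) at_top"
  proof (rule Lim_null_comparison)
    show "\<forall>\<^sub>F R in at_top. norm (?d R) \<le> 2 / sqrt pi / R"
      using eventually_gt_at_top[of 0] by eventually_elim (rule erf_vertical_bound)
    show "((\<lambda>R. 2 / sqrt pi / R) \<longlongrightarrow> 0) at_top" by real_asymp
  qed
  from tendsto_add[OF this erf_of_real_at_top]
  have "((\<lambda>R. erf (of_real R - \<i> * of_real R)) \<longlongrightarrow> 1) at_top" by simp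
  moreover have "filterlim (\<lambda>u::real. u / sqrt 2) at_top at_top" by real_asymp
  ultimately have "((\<lambda>u. erf (of_real (u / sqrt 2) - \<i> * of_real (u / sqrt 2))) \<longlongrightarrow> 1) at_top"
    by (rule filterlim_compose)
  moreover have "of_real (u / sqrt 2) - \<i> * of_real (u / sqrt 2) = rot8 * of_real u" for u
    by (simp add: rot8_eq diff_divide_distrib algebra_simps)
  ultimately show ?thesis by simp
qed

lemma erf_rot8_has_vector_derivative:
  "((\<lambda>t::real. erf (rot8 * of_real t)) has_vector_derivative
     2 * rot8 / of_real (sqrt pi) * exp (\<i> * of_real (t\<^sup>2))) (at t within A)"
proof -
  have "((\<lambda>w. erf (rot8 * w)) has_field_derivative
      2 / of_real (sqrt pi) * exp (- (rot8 * of_real t)\<^sup>2) * rot8) (at (of_real t))"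
    by (auto intro!: derivative_eq_intros)
  from has_vector_derivative_real_field[OF this] show ?thesis
    by (simp add: power_mult_distrib rot8_square mult_ac)
qed

text \<open>
  Up to the factor \<open>2 rot8 / sqrt \<pi>\<close>, \<open>u \<mapsto> erf (rot8 u)\<close> is a primitive of \<open>exp (\<i> t\<^sup>2)\<close>. Its value
  at \<open>- \<infinity>\<close> is \<open>- 1\<close>, by oddness and the limit at \<open>+ \<infinity>\<close>.
\<close>

lemma erfc_rot8_eq_integral:
  "erfc (- rot8 * of_real u) =
     (1 - \<i>) * of_real (sqrt (2 / pi)) * integral {..u} (\<lambda>t. exp (\<i> * of_real (t\<^sup>2)))"
proof -
  let ?k = "2 * rot8 / of_real (sqrt pi)"
  let ?f = "\<lambda>t::real. exp (\<i> * of_real (t\<^sup>2))"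
  let ?F = "\<lambda>R::real. erf (rot8 * of_real R)"
  have ftc: "((\<lambda>t. ?k * ?f t) has_integral (?F u - ?F R)) {R..u}" if "R \<le> u" for R
    using that by (intro fundamental_theorem_of_calculus erf_rot8_has_vector_derivative)
  have "(?F \<longlongrightarrow> - 1) at_bot"
    using tendsto_minus[OF erf_rot8_at_top] by (simp add: at_bot_mirror filterlim_filtermap)
  then have lim: "((\<lambda>R. ?F u - ?F R) \<longlongrightarrow> ?F u - - 1) at_bot"
    by (intro tendsto_intros)
  have "((\<lambda>t. ?k * ?f t) has_integral (?F u - - 1)) {..u}"
  proof (subst has_integral_atMost_iff_tendsto)
    show "(\<lambda>t. ?k * ?f t) integrable_on {R..u}" for R
      by (intro integrable_continuous_real continuous_intros)
    show "((\<lambda>R. integral {R..u} (\<lambda>t. ?k * ?f t)) \<longlongrightarrow> ?F u - - 1) at_bot"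
      by (rule Lim_transform_eventually[OF lim])
         (use integral_unique[OF ftc, symmetric] in \<open>auto simp: eventually_at_bot_linorder\<close>)
  qed
  then have "?k * integral {..u} ?f = ?F u + 1"
    by (simp only: integral_unique minus_minus diff_minus_eq_add flip: integral_mult_right)
  moreover have "?k = (1 - \<i>) * of_real (sqrt (2 / pi))"
  proof -
    have "2 / sqrt 2 / sqrt pi = sqrt (2 / pi)"
      by (simp add: real_div_sqrt real_sqrt_divide)
    from arg_cong[OF this, of complex_of_real] show ?thesis
      by (simp add: rot8_eq field_simps)
  qed
  ultimately show ?thesis by (simp add: erfc_def add.commute)
qed

section \<open>A uniform bound on the ray\<close>

lemma erf_rot8_small:
  assumes "u \<ge> 0"
  shows "norm (erf (rot8 * of_real u)) \<le> 2 / sqrt pi * u"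
proof (cases "u = 0")
  case False
  then have u: "0 < u" using assms by simp
  let ?f = "\<lambda>t::real. erf (rot8 * of_real t)"
  let ?\<phi> = "\<lambda>t::real. 2 / sqrt pi * t"
  have \<phi>: "(?\<phi> has_vector_derivative 2 / sqrt pi) (at t within A)" for t A
    unfolding has_real_derivative_iff_has_vector_derivative[symmetric]
    by (auto intro!: derivative_eq_intros)
  have "norm (?f u - ?f 0) \<le> ?\<phi> u - ?\<phi> 0"
  proof (rule differentiable_bound_general[OF u _ _ erf_rot8_has_vector_derivative \<phi>])
    show "continuous_on {0..u} ?f" "continuous_on {0..u} ?\<phi>"
      using erf_rot8_has_vector_derivative \<phi> by (auto intro!: continuous_on_vector_derivative)
    show "norm (2 * rot8 / of_real (sqrt pi) * exp (\<i> * of_real (t\<^sup>2))) \<le> 2 / sqrt pi" for t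
      by (simp add: norm_mult norm_divide norm_exp_eq_Re)
  qed
  then show ?thesis by simp
qed simp

text \<open>
  The boundary terms of two integrations by parts of \<open>exp (\<i> t\<^sup>2)\<close>: the derivative is \<open>exp (\<i> t\<^sup>2)\<close> up
  to a relative error \<open>3 / (4 t ^ 4)\<close>. The error after a single integration by parts, of order
  \<open>t ^ (- 2)\<close>, would be too large near \<open>t = sqrt 2\<close> for the bound \<open>norm_erf_rot8_le\<close>.
\<close>

definition fresnel_boundary :: "real \<Rightarrow> complex" where
  "fresnel_boundary t = exp (\<i> * of_real (t\<^sup>2)) * (1 / (2 * \<i> * of_real t) - 1 / (4 * of_real t ^ 3))"

lemma fresnel_boundary_has_vector_derivative:
  assumes "t \<noteq> 0"
  shows "(fresnel_boundary has_vector_derivative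
           exp (\<i> * of_real (t\<^sup>2)) * (1 + 3 / (4 * of_real t ^ 4))) (at t within A)"
proof -
  let ?E = "\<lambda>w::complex. exp (\<i> * w\<^sup>2)"
  have "((\<lambda>w. ?E w * (1 / (2 * \<i> * w) - 1 / (4 * w ^ 3))) has_field_derivative
      ?E w * (1 + 3 / (4 * w ^ 4))) (at w)" if "w \<noteq> 0" for w
    using that
    by (auto intro!: derivative_eq_intros) (simp add: field_simps eval_nat_numeral)
  from has_vector_derivative_real_field[OF this[of "of_real t"]] assms show ?thesis
    by (simp add: fresnel_boundary_def[abs_def])
qed

lemma norm_fresnel_boundary:
  assumes "t > 0"
  shows "norm (fresnel_boundary t) = sqrt (1 / (16 * t ^ 6) + 1 / (4 * t\<^sup>2))"
proof -
  have "1 / (2 * \<i> * of_real t) - 1 / (4 * of_real t ^ 3) = Complex (- (1 / (4 * t ^ 3))) (- (1 / (2 * t)))"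
  proof -
    have "1 / (2 * \<i> * of_real t) = - \<i> * of_real (1 / (2 * t))"
      using assms by (simp add: field_simps)
    moreover have "1 / (4 * of_real t ^ 3) = complex_of_real (1 / (4 * t ^ 3))" by simp
    ultimately show ?thesis by (simp only: complex_eq_iff) simp
  qed
  then show ?thesis
    unfolding fresnel_boundary_def norm_mult
    by (simp add: norm_exp_eq_Re complex_norm power_divide power_mult_distrib flip: power_mult)
qed

lemma fresnel_boundary_at_top: "(fresnel_boundary \<longlongrightarrow> 0) at_top"
proof (rule Lim_null_comparison)
  show "\<forall>\<^sub>F t in at_top. norm (fresnel_boundary t) \<le> sqrt (1 / (16 * t ^ 6) + 1 / (4 * t\<^sup>2))"
    using eventually_gt_at_top[of 0] by eventually_elim (simp add: norm_fresnel_boundary)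
  show "((\<lambda>t. sqrt (1 / (16 * t ^ 6) + 1 / (4 * t\<^sup>2))) \<longlongrightarrow> 0) at_top" by real_asymp
qed

text \<open>
  The difference of \<open>erf (rot8 t)\<close> and the boundary terms has a derivative of modulus
  \<open>2 / sqrt \<pi> * 3 / (4 t ^ 4)\<close> and tends to 1, so its distance from 1 is at most the integral of this
  modulus over \<open>t \<ge> u\<close>.
\<close>

lemma erf_rot8_asymptotic:
  assumes "u > 0"
  shows "norm (1 - (erf (rot8 * of_real u) - 2 * rot8 / of_real (sqrt pi) * fresnel_boundary u)) \<le> 2 / sqrt pi * (1 / (4 * u ^ 3))"
proof -
  let ?k = "2 * rot8 / of_real (sqrt pi)"
  let ?A = "\<lambda>t::real. erf (rot8 * of_real t) - ?k * fresnel_boundary t"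
  let ?A' = "\<lambda>t::real. ?k * exp (\<i> * of_real (t\<^sup>2)) - ?k * (exp (\<i> * of_real (t\<^sup>2)) * (1 + 3 / (4 * of_real t ^ 4)))"
  let ?\<phi> = "\<lambda>t::real. - (2 / sqrt pi * (1 / (4 * t ^ 3)))"
  let ?\<phi>' = "\<lambda>t::real. 2 / sqrt pi * (3 / (4 * t ^ 4))"
  have A: "(?A has_vector_derivative ?A' t) (at t within S)" if "t > 0" for t S
    using that
    by (intro has_vector_derivative_diff erf_rot8_has_vector_derivative
          has_vector_derivative_mult_right fresnel_boundary_has_vector_derivative) auto
  have \<phi>: "(?\<phi> has_vector_derivative ?\<phi>' t) (at t within S)" if "t > 0" for t S
    unfolding has_real_derivative_iff_has_vector_derivative[symmetric]
    using that by (auto intro!: derivative_eq_intros simp: field_simps power3_eq_cube power4_eq_xxxx power2_eq_square)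
  have bound: "norm (?A R - ?A u) \<le> 2 / sqrt pi * (1 / (4 * u ^ 3))" if "R > u" for R
  proof -
    have "norm (?A R - ?A u) \<le> ?\<phi> R - ?\<phi> u"
    proof (rule differentiable_bound_general[OF that])
      show "continuous_on {u..R} ?A"
        by (rule continuous_on_vector_derivative[OF A]) (use assms in auto)
      show "continuous_on {u..R} ?\<phi>"
        by (rule continuous_on_vector_derivative[OF \<phi>]) (use assms in auto)
      fix t assume t: "u < t" "t < R"
      show "(?A has_vector_derivative ?A' t) (at t)" "(?\<phi> has_vector_derivative ?\<phi>' t) (at t)"
        using A \<phi> assms t by auto
      have "?A' t = - (?k * exp (\<i> * of_real (t\<^sup>2)) * of_real (3 / (4 * t ^ 4)))"
        by (simp add: algebra_simps)
      then show "norm (?A' t) \<le> ?\<phi>' t"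
        using assms t by (simp add: norm_mult norm_divide norm_exp_eq_Re norm_power)
    qed
    also have "\<dots> \<le> 2 / sqrt pi * (1 / (4 * u ^ 3))"
      using assms that by simp
    finally show ?thesis .
  qed
  have lim: "((\<lambda>R. ?A R - ?A u) \<longlongrightarrow> 1 - ?k * 0 - ?A u) at_top"
    by (intro tendsto_intros erf_rot8_at_top fresnel_boundary_at_top)
  have "\<forall>\<^sub>F R in at_top. norm (?A R - ?A u) \<le> 2 / sqrt pi * (1 / (4 * u ^ 3))"
    using eventually_gt_at_top[of u] by eventually_elim (rule bound)
  from Lim_norm_ubound[OF _ lim this] show ?thesis by simp
qed

text \<open>
  The bound equals \<open>2 / sqrt \<pi> * sqrt 2\<close>, which the trivial estimate reaches exactly at
  \<open>u = sqrt 2\<close>. Beyond this point the boundary terms are at most \<open>3 / 8\<close> and the remainder at most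
  \<open>1 / 8\<close>, so that \<open>\<bar>erf (rot8 u)\<bar> \<le> 1 + 1 / sqrt \<pi>\<close>, and \<open>1 + sqrt \<pi> \<le> 2 sqrt 2\<close>.
\<close>

lemma norm_erf_rot8_le: "norm (erf (rot8 * of_real u)) \<le> 2 * sqrt (2 / pi)"
proof -
  have "norm (erf (rot8 * of_real u)) \<le> 2 / sqrt pi * sqrt 2" if "u \<ge> 0" for u
  proof (cases "u \<le> sqrt 2")
    case True
    have "norm (erf (rot8 * of_real u)) \<le> 2 / sqrt pi * u"
      by (rule erf_rot8_small[OF that])
    also have "\<dots> \<le> 2 / sqrt pi * sqrt 2"
      using True by (intro mult_left_mono) auto
    finally show ?thesis .
  next
    case False
    have u: "u > 0" using that False by (cases "u = 0") auto
    have u2: "u\<^sup>2 \<ge> 2" using False by (simp add: real_le_lsqrt sqrt_le_D)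
    have u3: "u ^ 3 \<ge> 2"
    proof -
      have "u \<ge> 1" using False by (smt (verit) real_sqrt_ge_one)
      then have "2 * 1 \<le> u\<^sup>2 * u" using u2 by (intro mult_mono) auto
      then show ?thesis by (simp add: power2_eq_square power3_eq_cube)
    qed
    have tail: "norm (fresnel_boundary u) \<le> 3 / 8"
    proof -
      have "u ^ 6 = (u\<^sup>2) ^ 3" by (simp flip: power_mult)
      also have "\<dots> \<ge> 2 ^ 3" using u2 by (intro power_mono) auto
      finally have "1 / (16 * u ^ 6) \<le> 1 / (16 * 8)" by (intro frac_le) auto
      moreover have "1 / (4 * u\<^sup>2) \<le> 1 / (4 * 2)" using u2 by (intro frac_le) auto
      ultimately have "sqrt (1 / (16 * u ^ 6) + 1 / (4 * u\<^sup>2)) \<le> 3 / 8"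
        by (intro real_le_lsqrt) (auto simp: power2_eq_square)
      then show ?thesis by (simp add: norm_fresnel_boundary[OF u])
    qed
    let ?e = "erf (rot8 * of_real u)" and ?g = "2 * rot8 / of_real (sqrt pi) * fresnel_boundary u"
    have "norm ?e = norm (1 - (1 - (?e - ?g)) + ?g)" by simp
    also have "\<dots> \<le> norm (1::complex) + norm (1 - (?e - ?g)) + norm ?g"
      by (rule norm_triangle_le[OF add_right_mono[OF norm_triangle_ineq4]])
    also have "\<dots> \<le> 1 + 2 / sqrt pi * (1 / 8) + 2 / sqrt pi * (3 / 8)"
    proof (intro add_mono)
      have "norm (1 - (?e - ?g)) \<le> 2 / sqrt pi * (1 / (4 * u ^ 3))"
        by (rule erf_rot8_asymptotic[OF u])
      also have "\<dots> \<le> 2 / sqrt pi * (1 / (4 * 2))"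
        using u3 by (intro mult_left_mono frac_le) auto
      finally show "norm (1 - (?e - ?g)) \<le> 2 / sqrt pi * (1 / 8)" by simp
      have "norm ?g = 2 / sqrt pi * norm (fresnel_boundary u)"
        by (simp add: norm_mult norm_divide)
      also have "\<dots> \<le> 2 / sqrt pi * (3 / 8)"
        using tail by (intro mult_left_mono) auto
      finally show "norm ?g \<le> 2 / sqrt pi * (3 / 8)" .
    qed simp
    also have "\<dots> = (sqrt pi + 1) / sqrt pi" by (simp add: field_simps)
    also have "\<dots> \<le> (2 * sqrt 2) / sqrt pi"
    proof (intro divide_right_mono)
      have "sqrt pi \<le> 9 / 5" using pi_approx(2) by (intro real_le_lsqrt) (auto simp: power2_eq_square)
      moreover have "7 / 5 \<le> sqrt 2" by (intro real_le_rsqrt) (auto simp: power2_eq_square)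
      ultimately show "sqrt pi + 1 \<le> 2 * sqrt 2" by simp
    qed simp
    finally show ?thesis by simp
  qed
  from this[of "\<bar>u\<bar>"] show ?thesis
    by (cases "u \<ge> 0") (simp_all add: real_sqrt_divide)
qed

section \<open>The cosine series in closed form\<close>

text \<open>
  Both sides solve the same first-order linear differential equation in \<open>y\<close>. The integrating factor
  \<open>exp (- 2 y\<^sup>2 cos (2 \<theta>))\<close> turns the Gaussian \<open>exp (- 2 y\<^sup>2)\<close> into \<open>exp (- (2 y cos \<theta>)\<^sup>2)\<close>, because
  \<open>1 + cos (2 \<theta>) = 2 (cos \<theta>)\<^sup>2\<close>; that is why an error function appears.
\<close>

lemma cosine_series_eq_erf:
  fixes y :: complex and \<theta> :: real
  defines "W \<equiv> (\<Sum>k. of_real (cos (real k * \<theta>)) * half_order_I k y)"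
  shows "2 * W - half_order_I 0 y =
           exp (2 * y\<^sup>2 * of_real (cos (2 * \<theta>))) * (1 + erf (2 * y * of_real (cos \<theta>)))"
proof -
  define S where "S = (\<lambda>y. \<Sum>k. of_real (cos (real k * \<theta>)) * half_order_I k y)"
  define c where "c = complex_of_real (cos \<theta>)"
  define C where "C = complex_of_real (cos (2 * \<theta>))"
  define H where "H = (\<lambda>y. exp (- (2 * y\<^sup>2 * C)) * (2 * S y - half_order_I 0 y) - erf (2 * y * c))"
  have cC: "C = 2 * c\<^sup>2 - 1"
    unfolding C_def c_def using arg_cong[OF cos_double_cos[of \<theta>], of complex_of_real] by simp
  have dS: "(S has_field_derivative
      (4 * y * C * S y + 2 * c * exp (- 2 * y\<^sup>2) / of_real (sqrt pi)
        + 2 * y * half_order_I 2 y - 2 * y * C * half_order_I 0 y)) (at y)" for y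
    using DERIV_cosine_series[of \<theta> y] sums_unique[OF cosine_series_derivative_sums[of \<theta> y]]
    unfolding S_def c_def C_def by simp
  have "(H has_field_derivative 0) (at y)" for y
  proof -
    let ?D = "2 * S y - half_order_I 0 y"
    let ?g = "4 * c * exp (- 2 * y\<^sup>2) / of_real (sqrt pi)"
    have dD: "((\<lambda>y. 2 * S y - half_order_I 0 y) has_field_derivative (4 * y * C * ?D + ?g)) (at y)"
      by (rule DERIV_cong[OF DERIV_diff[OF DERIV_cmult[OF dS] DERIV_half_order_I]])
         (simp only: half_order_I'_0, simp add: algebra_simps)
    define e1 e2 e3 where "e1 = exp (- (2 * y\<^sup>2 * C))" and "e2 = exp (- 2 * y\<^sup>2)"
      and "e3 = exp (- (2 * y * c)\<^sup>2)"
    have "e1 * e2 = e3"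
      by (simp add: e1_def e2_def e3_def cC power_mult_distrib algebra_simps flip: exp_add)
    have "(H has_field_derivative
        e1 * (- (4 * y * C)) * ?D + (4 * y * C * ?D + 4 * c * e2 / of_real (sqrt pi)) * e1
          - 2 / of_real (sqrt pi) * e3 * (2 * c)) (at y)"
      unfolding H_def e1_def e2_def e3_def
      by (intro DERIV_diff DERIV_mult dD) (auto intro!: derivative_eq_intros)
    then show ?thesis
      by (rule DERIV_cong) (simp add: algebra_simps flip: \<open>e1 * e2 = e3\<close>)
  qed
  then have "\<exists>h. \<forall>y\<in>UNIV. H y = h"
    by (intro has_field_derivative_zero_constant) auto
  then have "H y = H 0" by auto
  also have "H 0 = 1"
  proof -
    have I0: "half_order_I k 0 = (if k = 0 then 1 else 0)" for k
      by (simp add: half_order_I_def bessel_clifford_0 rGamma_inverse_Gamma)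
    have "S 0 = (\<Sum>k\<in>{0}. of_real (cos (real k * \<theta>)) * half_order_I k 0)"
      unfolding S_def by (rule suminf_finite) (auto simp: I0)
    then show ?thesis by (simp add: H_def I0)
  qed
  finally have "2 * S y - half_order_I 0 y = exp (2 * y\<^sup>2 * C) * (1 + erf (2 * y * c))"
    by (simp add: H_def exp_minus field_simps)
  then show ?thesis
    by (simp only: W_def S_def C_def c_def)
qed

section \<open>The deformed kernel for \<open>a = 4\<close>\<close>

text \<open>
  Put \<open>y = rot8 z / 2\<close>. Then \<open>y ^ 4\<close> is the negative argument that distinguishes \<open>J\<close> from \<open>I\<close>, and the power \<open>y ^ k\<close> contains the phase of the
  \<open>k\<close>-th term of the kernel.
\<close>

lemma deformed_kernel_4_eq_erfc:
  assumes "z > 0" "\<theta> \<in> {0..pi}"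
  shows "deformed_kernel 4 z (cos \<theta>) =
     exp (- (\<i> / 2) * of_real (z\<^sup>2 * cos (2 * \<theta>))) * erfc (- rot8 * of_real (z * cos \<theta>))"
proof -
  define y where "y = rot8 * of_real (z / 2)"
  have y2: "y\<^sup>2 = - \<i> * of_real (z\<^sup>2 / 4)"
    by (simp add: y_def power_mult_distrib rot8_square power_divide)
  have y4: "y ^ 4 = - of_real ((deformed_arg 4 z / 2)\<^sup>2)"
  proof -
    have "y ^ 4 = (y\<^sup>2)\<^sup>2" by (simp flip: power_mult)
    then show ?thesis
      using assms by (simp add: y2 deformed_arg_def power_mult_distrib power_divide powr_numeral)
  qed
  have w: "deformed_arg 4 z > 0" using assms by (simp add: deformed_arg_def)
  have root: "(deformed_arg 4 z / 2) powr (real k / 2) = (z / 2) ^ k" for k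
  proof -
    have "deformed_arg 4 z / 2 = (z / 2) powr 2"
      using assms by (simp add: deformed_arg_def powr_divide)
    then show ?thesis
      using assms by (simp only: powr_powr) (simp add: powr_realpow)
  qed
  have J: "rot8 ^ k * of_real (bessel_J (real k / 2) (deformed_arg 4 z)) = half_order_I k y" for k
  proof -
    have "half_order_I k y = (rot8 ^ k * of_real ((z / 2) ^ k))
        * bessel_clifford (real k / 2) (- of_real ((deformed_arg 4 z / 2)\<^sup>2))"
      unfolding half_order_I_def y4 by (simp only: y_def power_mult_distrib of_real_power)
    then show ?thesis
      using bessel_J_eq_bessel_clifford[OF w, of "real k / 2"] by (simp only: root mult.assoc)
  qed
  have term_eq: "kernel_term 4 z (cos \<theta>) k = of_real (cos (real k * \<theta>)) * half_order_I k y" for k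
  proof -
    have "exp (- (\<i> * of_real pi * of_nat k / of_real 4)) = rot8 ^ k"
      by (simp add: rot8_def exp_of_nat_mult[symmetric] mult_ac)
    moreover have "2 * real k / 4 = real k / 2" by simp
    ultimately show ?thesis
      using assms by (simp only: kernel_term_def J) (simp add: arccos_cos)
  qed
  have "summable (\<lambda>k. of_real (cos (real k * \<theta>)) * half_order_I k y)"
    by (intro summable_bounded_mult_half_order_I) auto
  then have "(\<Sum>k. of_real (cos (real (Suc k) * \<theta>)) * half_order_I (Suc k) y)
      = (\<Sum>k. of_real (cos (real k * \<theta>)) * half_order_I k y) - half_order_I 0 y"
    by (subst suminf_split_head) simp_all
  moreover have "of_real (bessel_J 0 (deformed_arg 4 z)) = half_order_I 0 y"
    using J[of 0] by simp
  ultimately have "deformed_kernel 4 z (cos \<theta>)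
      = 2 * (\<Sum>k. of_real (cos (real k * \<theta>)) * half_order_I k y) - half_order_I 0 y"
    by (simp add: deformed_kernel_def term_eq)
  also have "\<dots> = exp (2 * y\<^sup>2 * of_real (cos (2 * \<theta>))) * (1 + erf (2 * y * of_real (cos \<theta>)))"
    by (rule cosine_series_eq_erf)
  also have "2 * y\<^sup>2 * of_real (cos (2 * \<theta>)) = - (\<i> / 2) * of_real (z\<^sup>2 * cos (2 * \<theta>))"
    by (simp add: y2)
  also have "1 + erf (2 * y * of_real (cos \<theta>)) = erfc (- rot8 * of_real (z * cos \<theta>))"
    by (simp add: erfc_def y_def mult_ac)
  finally show ?thesis .
qed

lemma norm_deformed_kernel_4:
  assumes "z > 0" "\<theta> \<in> {0..pi}"
  shows "norm (deformed_kernel 4 z (cos \<theta>)) = norm (1 + erf (rot8 * of_real (z * cos \<theta>)))"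
  using deformed_kernel_4_eq_erfc[OF assms]
  by (simp add: norm_mult norm_exp_eq_Re erfc_def)

theorem theorem2p1:
  shows "(\<forall>z>0. \<forall>\<theta>\<in>{0..pi}.
            deformed_kernel 4 z (cos \<theta>) =
              exp (- \<i> * of_real (z\<^sup>2 * ((cos \<theta>)\<^sup>2 - 1 / 2))) *
              erfc (- exp (- \<i> * of_real (pi / 4)) * of_real (z * cos \<theta>)) \<and>
            deformed_kernel 4 z (cos \<theta>) =
              (1 - \<i>) * of_real (sqrt (2 / pi)) *
              exp (- (\<i> / 2) * of_real (z\<^sup>2 * cos (2 * \<theta>))) *
              integral {..z * cos \<theta>} (\<lambda>t. exp (\<i> * of_real (t\<^sup>2)))) \<and>
         (\<forall>z>0. \<forall>\<xi>\<in>{- 1..1}. cmod (deformed_kernel 4 z \<xi>) \<le> 1 + 2 * sqrt (2 / pi)) \<and>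
         ((\<lambda>z. cmod (deformed_kernel 4 z 1)) \<longlongrightarrow> 2) at_top"
proof (intro conjI allI ballI impI)
  fix z \<theta> :: real
  assume z: "z > 0" and \<theta>: "\<theta> \<in> {0..pi}"
  note K = deformed_kernel_4_eq_erfc[OF z \<theta>]
  have "- (\<i> / 2) * of_real (z\<^sup>2 * cos (2 * \<theta>)) = - \<i> * of_real (z\<^sup>2 * ((cos \<theta>)\<^sup>2 - 1 / 2))"
    unfolding cos_double_cos by (simp add: algebra_simps)
  with K show "deformed_kernel 4 z (cos \<theta>) =
      exp (- \<i> * of_real (z\<^sup>2 * ((cos \<theta>)\<^sup>2 - 1 / 2))) *
      erfc (- exp (- \<i> * of_real (pi / 4)) * of_real (z * cos \<theta>))"
    unfolding rot8_def by (simp only:)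
  show "deformed_kernel 4 z (cos \<theta>) =
      (1 - \<i>) * of_real (sqrt (2 / pi)) * exp (- (\<i> / 2) * of_real (z\<^sup>2 * cos (2 * \<theta>))) *
      integral {..z * cos \<theta>} (\<lambda>t. exp (\<i> * of_real (t\<^sup>2)))"
    unfolding K erfc_rot8_eq_integral by (simp only: mult_ac)
next
  fix z \<xi> :: real
  assume z: "z > 0" and \<xi>: "\<xi> \<in> {- 1..1}"
  have "cmod (deformed_kernel 4 z \<xi>) = norm (1 + erf (rot8 * of_real (z * \<xi>)))"
    using norm_deformed_kernel_4[OF z, of "arccos \<xi>"] \<xi> by (simp add: arccos_lbound arccos_ubound)
  also have "\<dots> \<le> norm (1::complex) + norm (erf (rot8 * of_real (z * \<xi>)))"
    by (rule norm_triangle_ineq)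
  also have "\<dots> \<le> 1 + 2 * sqrt (2 / pi)"
    using norm_erf_rot8_le[of "z * \<xi>"] by (simp only: norm_one add_left_mono)
  finally show "cmod (deformed_kernel 4 z \<xi>) \<le> 1 + 2 * sqrt (2 / pi)" .
next
  have "((\<lambda>z. norm (1 + erf (rot8 * of_real z))) \<longlongrightarrow> norm (1 + 1 :: complex)) at_top"
    by (intro tendsto_intros erf_rot8_at_top)
  moreover have "\<forall>\<^sub>F z in at_top. norm (1 + erf (rot8 * of_real z)) = cmod (deformed_kernel 4 z 1)"
    using eventually_gt_at_top[of 0]
  proof eventually_elim
    case (elim z)
    then show ?case using norm_deformed_kernel_4[of z 0] by simp
  qed
  ultimately show "((\<lambda>z. cmod (deformed_kernel 4 z 1)) \<longlongrightarrow> 2) at_top"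
    by (simp add: Lim_transform_eventually)
qed

end
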